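(* Every uniquely $\sqrt{J}$-clean ring $R$ is a Dedekind finite ring.
   Context: Rings are associative with identity $1\neq 0$ (not necessarily commutative). $J(R)$ is the Jacobson radical of $R$, and $\sqrt{J(R)}=\{z\in R : z^n\in J(R)\text{ for some } n\ge 1\}$. A ring $R$ is uniquely $\sqrt{J}$-clean if every $a\in R$ can be written in exactly one way as $a=e+z$ with $e$ an idempotent of $R$ and $z\in\sqrt{J(R)}$. A ring $R$ is Dedekind finite if $ab=1$ implies $ba=1$ for all $a,b\in R$. *)

theory Defs
  imports "HOL-Algebra.Ideal"
begin

text \<open>Rings need not be commutative, and \<^locale>\<open>ideal\<close> is two-sided, so one-sided
  ideals are introduced here.\<close>

locale left_ideal = additive_subgroup I R + ring R for I and R (structure) +
  assumes left_closed: "\<lbrakk>x \<in> carrier R; a \<in> I\<rbrakk> \<Longrightarrow> x \<otimes> a \<in> I"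

locale maximal_left_ideal = left_ideal +
  assumes proper: "I \<noteq> carrier R"
    and maximal: "\<lbrakk>left_ideal K R; I \<subseteq> K\<rbrakk> \<Longrightarrow> K = I \<or> K = carrier R"

definition jacobson_radical :: "('a, 'b) ring_scheme \<Rightarrow> 'a set"
  where "jacobson_radical R = {x \<in> carrier R. \<forall>M. maximal_left_ideal M R \<longrightarrow> x \<in> M}"

definition sqrt_jacobson :: "('a, 'b) ring_scheme \<Rightarrow> 'a set"
  where "sqrt_jacobson R =
    {z \<in> carrier R. \<exists>n::nat. n \<ge> 1 \<and> z [^]\<^bsub>R\<^esub> n \<in> jacobson_radical R}"

definition ring_idempotents :: "('a, 'b) ring_scheme \<Rightarrow> 'a set"
  where "ring_idempotents R = {e \<in> carrier R. e \<otimes>\<^bsub>R\<^esub> e = e}"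

definition uniquely_sqrt_jacobson_clean :: "('a, 'b) ring_scheme \<Rightarrow> bool"
  where "uniquely_sqrt_jacobson_clean R \<longleftrightarrow>
    (\<forall>a \<in> carrier R. \<exists>!p. p \<in> ring_idempotents R \<times> sqrt_jacobson R \<and> a = fst p \<oplus>\<^bsub>R\<^esub> snd p)"

definition dedekind_finite :: "('a, 'b) ring_scheme \<Rightarrow> bool"
  where "dedekind_finite R \<longleftrightarrow>
    (\<forall>a \<in> carrier R. \<forall>b \<in> carrier R. a \<otimes>\<^bsub>R\<^esub> b = \<one>\<^bsub>R\<^esub> \<longrightarrow> b \<otimes>\<^bsub>R\<^esub> a = \<one>\<^bsub>R\<^esub>)"

end

theory Submission
  imports Defs
begin

text \<open>
  Suppose \<open>a b = 1\<close>. Then \<open>e = b a\<close> is idempotent, and \<open>t = b (1 - b a)\<close> lies in the Peirce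
  corner \<open>e R (1 - e)\<close>: \<open>e t = t\<close> and \<open>t e = t t = 0\<close>. Hence \<open>e + t\<close> is idempotent as well, and
  \<open>(e + t) + 0\<close> and \<open>e + t\<close> are two decompositions of this one element into an idempotent and an
  element of \<open>\<surd>J(R)\<close>. Uniqueness forces \<open>t = 0\<close>, and multiplying \<open>b (1 - b a) = 0\<close> by \<open>a\<close> on the
  left gives \<open>b a = 1\<close>.
\<close>

lemma (in ring) square_zero_in_sqrt_jacobson:
  assumes "t \<in> carrier R" and "t \<otimes> t = \<zero>"
  shows "t \<in> sqrt_jacobson R"
proof -
  have "\<zero> \<in> jacobson_radical R"
    by (auto simp: jacobson_radical_def maximal_left_ideal_def left_ideal_def
        intro: additive_subgroup.zero_closed)
  moreover have "t [^] (2::nat) = \<zero>"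
    using assms by (simp add: numeral_2_eq_2)
  ultimately show ?thesis
    using assms(1) unfolding sqrt_jacobson_def by (auto intro!: exI[of _ "2::nat"])
qed

text \<open>An idempotent is already decomposed, with second summand \<open>0\<close>. So it cannot be reached
  from another idempotent by adding a nonzero element of square zero.\<close>

lemma (in ring) square_zero_between_idempotents:
  assumes clean: "uniquely_sqrt_jacobson_clean R"
    and e: "e \<in> ring_idempotents R" and sum: "e \<oplus> t \<in> ring_idempotents R"
    and t: "t \<in> carrier R" "t \<otimes> t = \<zero>"
  shows "t = \<zero>"
proof -
  let ?D = "\<lambda>p. p \<in> ring_idempotents R \<times> sqrt_jacobson R \<and> e \<oplus> t = fst p \<oplus> snd p"
  have et: "e \<oplus> t \<in> carrier R"
    using sum by (simp add: ring_idempotents_def)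
  then have "\<exists>!p. ?D p"
    using clean by (simp add: uniquely_sqrt_jacobson_clean_def)
  moreover have "?D (e, t)"
    using e t by (simp add: square_zero_in_sqrt_jacobson)
  moreover have "?D (e \<oplus> t, \<zero>)"
    using sum et by (simp add: square_zero_in_sqrt_jacobson)
  ultimately have "(e, t) = (e \<oplus> t, \<zero>)"
    by blast
  then show ?thesis by simp
qed

lemma (in ring) idempotent_add_corner:
  assumes e: "e \<in> ring_idempotents R" and t: "t \<in> carrier R"
    and corner: "e \<otimes> t = t" "t \<otimes> e = \<zero>" "t \<otimes> t = \<zero>"
  shows "e \<oplus> t \<in> ring_idempotents R"
  using assms by (simp add: ring_idempotents_def l_distr r_distr)

theorem lemma4p2:
  fixes R :: "('a, 'b) ring_scheme" (structure)
  assumes "ring R" and "\<one> \<noteq> \<zero>"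
    and "uniquely_sqrt_jacobson_clean R"
  shows "dedekind_finite R"
  unfolding dedekind_finite_def
proof (intro ballI impI)
  interpret ring R by fact
  fix a b
  assume a [simp]: "a \<in> carrier R" and b [simp]: "b \<in> carrier R" and ab: "a \<otimes> b = \<one>"
  define c where "c = \<one> \<ominus> b \<otimes> a"
  have c [simp]: "c \<in> carrier R"
    by (simp add: c_def)
  have ab_left: "a \<otimes> (b \<otimes> x) = x" if "x \<in> carrier R" for x
    using that ab by (simp flip: m_assoc)
  have cb: "c \<otimes> b = \<zero>"
    by (simp add: c_def minus_eq l_distr l_minus m_assoc ab r_neg)
  then have cb_left: "c \<otimes> (b \<otimes> x) = \<zero>" if "x \<in> carrier R" for x
    using that by (simp flip: m_assoc)
  have e: "b \<otimes> a \<in> ring_idempotents R"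
    by (simp add: ring_idempotents_def m_assoc ab_left)
  have sq: "(b \<otimes> c) \<otimes> (b \<otimes> c) = \<zero>"
    by (simp add: m_assoc cb_left)
  have "b \<otimes> a \<oplus> b \<otimes> c \<in> ring_idempotents R"
    by (rule idempotent_add_corner[OF e _ _ _ sq]) (simp_all add: m_assoc ab_left cb_left)
  then have "b \<otimes> c = \<zero>"
    using square_zero_between_idempotents[OF assms(3) e _ _ sq] by simp
  then have "c = \<zero>"
    using ab_left[OF c] by simp
  then have "\<one> \<oplus> \<ominus> (b \<otimes> a) = \<zero>"
    by (simp add: c_def minus_eq)
  then show "b \<otimes> a = \<one>"
    using minus_equality[of \<one> "\<ominus> (b \<otimes> a)"] by simp
qed

end
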